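(* Let $X$ be a set and let $\mathcal{B}_1,\mathcal{B}_2$ be s.i.p. reproducing kernel Banach spaces of complex-valued functions on $X$, with semi-inner products $[\cdot,\cdot]_1,[\cdot,\cdot]_2$ and reproducing kernels $K_i(x,y)=k_y^i(x)$, $i=1,2$. Let $f:X\to\mathbb{C}$ be a multiplier of $\mathcal{B}_1$ into $\mathcal{B}_2$, i.e. $fh\in\mathcal{B}_2$ for every $h\in\mathcal{B}_1$, and let $M_f:\mathcal{B}_1\to\mathcal{B}_2$ be the linear map $M_f(h)=fh$. Then for every $y\in X$, $$M_f^*(k_y^2)=\overline{f(y)}\,k_y^1 .$$
   Context: A reproducing kernel Banach space (RKBS) on $X$ is a reflexive Banach space $\mathcal{B}$ of functions $X\to\mathbb{C}$ (with pointwise operations) such that its topological dual $\mathcal{B}'$ is isometric to a Banach space of functions on $X$ and the point evaluations are continuous linear functionals on both $\mathcal{B}$ and $\mathcal{B}'$. An s.i.p. RKBS on $X$ is an RKBS on $X$ that is uniformly convex and uniformly Fréchet differentiable. Such a space $\mathcal{B}$ carries a (unique) semi-inner product $[\cdot,\cdot]_{\mathcal{B}}:\mathcal{B}\times\mathcal{B}\to\mathbb{C}$ compatible with its norm: it is linear in the first variable, satisfies $[g,\lambda h]_{\mathcal{B}}=\overline{\lambda}[g,h]_{\mathcal{B}}$ for $\lambda\in\mathbb{C}$, $[g,g]_{\mathcal{B}}=\|g\|^2$, and $|[g,h]_{\mathcal{B}}|\le\|g\|\,\|h\|$ (it need not be additive in the second variable). Riesz representation (known): for each $\varphi\in\mathcal{B}'$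 there is a unique $h\in\mathcal{B}$ with $\varphi=h^*$, where $h^*(g):=[g,h]_{\mathcal{B}}$ for $g\in\mathcal{B}$, and $\|\varphi\|_{\mathcal{B}'}=\|h\|_{\mathcal{B}}$. The reproducing kernel of $\mathcal{B}$ is the function $K:X\times X\to\mathbb{C}$ with $K(\cdot,y)\in\mathcal{B}$ and $[g,K(\cdot,y)]_{\mathcal{B}}=g(y)$ for all $g\in\mathcal{B}$, $y\in X$; write $k_y=K(\cdot,y)$. Adjoint: for a linear map $T:\mathcal{B}_1\to\mathcal{B}_2$, the adjoint $T^*$ has domain $D(T^* )=\{g^*: g\in\mathcal{B}_2,\ g^*\circ T \text{ is continuous on } \mathcal{B}_1\}$ and is given by $T^*g^*=g^*\circ T$. Elements of $\mathcal{B}_i$ are identified with functionals via $h\leftrightarrow h^*$. Thus, for $g\in\mathcal{B}_2$ with $g^*\in D(T^* )$, $T^*(g)$ denotes the unique element $u\in\mathcal{B}_1$ such that $[T h,g]_2=[h,u]_1$ for all $h\in\mathcal{B}_1$. The asserted equality includes that $(k_y^2)^*$ lies in $D(M_f^* )$. *)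

theory Defs
  imports "HOL-Analysis.Analysis" "HOL-Library.Function_Algebras"
begin

text \<open>
  A function \<open>X \<rightarrow> \<complex>\<close> on a set \<open>X :: 'a set\<close> is encoded as a total function that vanishes
  off \<open>X\<close>. The pointwise operations preserve this, and such functions are equal iff they agree
  on \<open>X\<close>. Addition, subtraction, zero and multiplication of functions are the pointwise ones of
  \<open>Function_Algebras\<close>.
\<close>

definition functions_on :: "'a set \<Rightarrow> ('a \<Rightarrow> complex) set" where
  "functions_on X = {g. \<forall>x. x \<notin> X \<longrightarrow> g x = 0}"

definition fscale :: "complex \<Rightarrow> ('a \<Rightarrow> complex) \<Rightarrow> 'a \<Rightarrow> complex"  (infixr \<open>*\<^sub>F\<close> 75) where
  "c *\<^sub>F g = (\<lambda>x. c * g x)"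

text \<open>
  A normed space of functions on \<open>X\<close> is given by its carrier \<open>B\<close> and its norm \<open>N\<close>; the values
  of \<open>N\<close> off \<open>B\<close> are irrelevant.
\<close>

locale normed_function_space =
  fixes X :: "'a set" and B :: "('a \<Rightarrow> complex) set" and N :: "('a \<Rightarrow> complex) \<Rightarrow> real"
  assumes on_X: "B \<subseteq> functions_on X"
    and zero_closed: "0 \<in> B"
    and add_closed: "\<lbrakk>g \<in> B; h \<in> B\<rbrakk> \<Longrightarrow> g + h \<in> B"
    and scale_closed: "g \<in> B \<Longrightarrow> c *\<^sub>F g \<in> B"
    and norm_nonneg: "g \<in> B \<Longrightarrow> 0 \<le> N g"
    and norm_eq_zero: "g \<in> B \<Longrightarrow> N g = 0 \<longleftrightarrow> g = 0"
    and norm_scale: "g \<in> B \<Longrightarrow> N (c *\<^sub>F g) = cmod c * N g"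
    and norm_triangle: "\<lbrakk>g \<in> B; h \<in> B\<rbrakk> \<Longrightarrow> N (g + h) \<le> N g + N h"

text \<open>
  \<open>Metric_space\<close> asks for nonnegativity and symmetry on the whole type, so the distance is set to
  zero off the carrier.
\<close>

definition norm_dist ::
  "('a \<Rightarrow> complex) set \<Rightarrow> (('a \<Rightarrow> complex) \<Rightarrow> real) \<Rightarrow> ('a \<Rightarrow> complex) \<Rightarrow> ('a \<Rightarrow> complex) \<Rightarrow> real"
where
  "norm_dist B N g h = (if g \<in> B \<and> h \<in> B then N (g - h) else 0)"

context normed_function_space
begin

lemma diff_closed: "g - h \<in> B" if "g \<in> B" "h \<in> B"
proof -
  have "g - h = g + (-1) *\<^sub>F h" by (auto simp: fscale_def)
  then show ?thesis using add_closed scale_closed that by metis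
qed

lemma norm_minus_commute: "N (g - h) = N (h - g)" if "g \<in> B" "h \<in> B"
proof -
  have "g - h = (-1) *\<^sub>F (h - g)" by (auto simp: fscale_def)
  then show ?thesis using norm_scale[OF diff_closed[OF that(2,1)], of "-1"] by simp
qed

end

sublocale normed_function_space \<subseteq> metric: Metric_space B "norm_dist B N"
proof
  show "0 \<le> norm_dist B N g h" for g h
    by (simp add: norm_dist_def norm_nonneg diff_closed)
  show "norm_dist B N g h = norm_dist B N h g" for g h
    by (simp add: norm_dist_def norm_minus_commute)
  show "norm_dist B N g h = 0 \<longleftrightarrow> g = h" if "g \<in> B" "h \<in> B" for g h
    using that by (simp add: norm_dist_def norm_eq_zero diff_closed)
  show "norm_dist B N g k \<le> norm_dist B N g h + norm_dist B N h k"
    if "g \<in> B" "h \<in> B" "k \<in> B" for g h k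
    using that norm_triangle[of "g - h" "h - k"] by (simp add: norm_dist_def diff_closed)
qed

locale banach_function_space = normed_function_space +
  assumes complete: metric.mcomplete

definition linear_functional_on ::
  "('a \<Rightarrow> complex) set \<Rightarrow> (('a \<Rightarrow> complex) \<Rightarrow> complex) \<Rightarrow> bool" where
  "linear_functional_on B \<phi> \<longleftrightarrow>
     (\<forall>g\<in>B. \<forall>h\<in>B. \<phi> (g + h) = \<phi> g + \<phi> h) \<and> (\<forall>c. \<forall>g\<in>B. \<phi> (c *\<^sub>F g) = c * \<phi> g)"

definition continuous_functional_on ::
  "('a \<Rightarrow> complex) set \<Rightarrow> (('a \<Rightarrow> complex) \<Rightarrow> real) \<Rightarrow> (('a \<Rightarrow> complex) \<Rightarrow> complex) \<Rightarrow> bool" where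
  "continuous_functional_on B N \<phi> \<longleftrightarrow>
     continuous_map (Metric_space.mtopology B (norm_dist B N)) euclidean \<phi>"

text \<open>
  The topological dual of \<open>B\<close> is again a space of functions, now on the set \<open>B\<close>, normed by
  the operator norm. Iterating the construction gives the bidual.
\<close>

definition dual_space ::
  "('a \<Rightarrow> complex) set \<Rightarrow> (('a \<Rightarrow> complex) \<Rightarrow> real) \<Rightarrow> (('a \<Rightarrow> complex) \<Rightarrow> complex) set" where
  "dual_space B N =
     {\<phi> \<in> functions_on B. linear_functional_on B \<phi> \<and> continuous_functional_on B N \<phi>}"

definition dual_norm ::
  "('a \<Rightarrow> complex) set \<Rightarrow> (('a \<Rightarrow> complex) \<Rightarrow> real) \<Rightarrow> (('a \<Rightarrow> complex) \<Rightarrow> complex) \<Rightarrow> real" where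
  "dual_norm B N \<phi> = (SUP g\<in>{g \<in> B. N g \<le> 1}. cmod (\<phi> g))"

definition reflexive_space ::
  "('a \<Rightarrow> complex) set \<Rightarrow> (('a \<Rightarrow> complex) \<Rightarrow> real) \<Rightarrow> bool" where
  "reflexive_space B N \<longleftrightarrow>
     (\<forall>\<Phi> \<in> dual_space (dual_space B N) (dual_norm B N).
        \<exists>g\<in>B. \<forall>\<phi> \<in> dual_space B N. \<Phi> \<phi> = \<phi> g)"

definition isometric_spaces ::
  "('a \<Rightarrow> complex) set \<Rightarrow> (('a \<Rightarrow> complex) \<Rightarrow> real) \<Rightarrow>
   ('b \<Rightarrow> complex) set \<Rightarrow> (('b \<Rightarrow> complex) \<Rightarrow> real) \<Rightarrow> bool" where
  "isometric_spaces B N C M \<longleftrightarrow>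
     (\<exists>J. bij_betw J B C \<and>
          (\<forall>g\<in>B. \<forall>h\<in>B. J (g + h) = J g + J h) \<and>
          (\<forall>c. \<forall>g\<in>B. J (c *\<^sub>F g) = c *\<^sub>F J g) \<and>
          (\<forall>g\<in>B. M (J g) = N g))"

definition rkbs ::
  "'a set \<Rightarrow> ('a \<Rightarrow> complex) set \<Rightarrow> (('a \<Rightarrow> complex) \<Rightarrow> real) \<Rightarrow> bool" where
  "rkbs X B N \<longleftrightarrow>
     banach_function_space X B N \<and> reflexive_space B N \<and>
     (\<forall>x\<in>X. continuous_functional_on B N (\<lambda>g. g x)) \<and>
     (\<exists>C M. banach_function_space X C M \<and>
            isometric_spaces (dual_space B N) (dual_norm B N) C M \<and>
            (\<forall>x\<in>X. continuous_functional_on C M (\<lambda>g. g x)))"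

definition uniformly_convex ::
  "('a \<Rightarrow> complex) set \<Rightarrow> (('a \<Rightarrow> complex) \<Rightarrow> real) \<Rightarrow> bool" where
  "uniformly_convex B N \<longleftrightarrow>
     (\<forall>\<epsilon>>0. \<exists>\<delta>>0. \<forall>g\<in>B. \<forall>h\<in>B.
        N g = 1 \<and> N h = 1 \<and> N (g - h) \<ge> \<epsilon> \<longrightarrow> N (g + h) \<le> 2 - \<delta>)"

text \<open>
  The real directional derivatives of the norm exist, the limit being uniform over pairs of unit
  vectors.
\<close>

definition uniformly_frechet_differentiable ::
  "('a \<Rightarrow> complex) set \<Rightarrow> (('a \<Rightarrow> complex) \<Rightarrow> real) \<Rightarrow> bool" where
  "uniformly_frechet_differentiable B N \<longleftrightarrow>
     (\<exists>D. uniform_limit ({g \<in> B. N g = 1} \<times> {h \<in> B. N h = 1})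
            (\<lambda>(t::real) (g, h). (N (g + complex_of_real t *\<^sub>F h) - N g) / t) D (at 0))"

definition sip_rkbs ::
  "'a set \<Rightarrow> ('a \<Rightarrow> complex) set \<Rightarrow> (('a \<Rightarrow> complex) \<Rightarrow> real) \<Rightarrow> bool" where
  "sip_rkbs X B N \<longleftrightarrow>
     rkbs X B N \<and> uniformly_convex B N \<and> uniformly_frechet_differentiable B N"

definition compatible_sip ::
  "('a \<Rightarrow> complex) set \<Rightarrow> (('a \<Rightarrow> complex) \<Rightarrow> real) \<Rightarrow>
   (('a \<Rightarrow> complex) \<Rightarrow> ('a \<Rightarrow> complex) \<Rightarrow> complex) \<Rightarrow> bool" where
  "compatible_sip B N s \<longleftrightarrow>
     (\<forall>h\<in>B. linear_functional_on B (\<lambda>g. s g h)) \<and>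
     (\<forall>c. \<forall>g\<in>B. \<forall>h\<in>B. s g (c *\<^sub>F h) = cnj c * s g h) \<and>
     (\<forall>g\<in>B. s g g = complex_of_real ((N g)\<^sup>2)) \<and>
     (\<forall>g\<in>B. \<forall>h\<in>B. cmod (s g h) \<le> N g * N h)"

definition reproducing_kernel ::
  "'a set \<Rightarrow> ('a \<Rightarrow> complex) set \<Rightarrow> (('a \<Rightarrow> complex) \<Rightarrow> ('a \<Rightarrow> complex) \<Rightarrow> complex) \<Rightarrow>
   ('a \<Rightarrow> 'a \<Rightarrow> complex) \<Rightarrow> bool" where
  "reproducing_kernel X B s K \<longleftrightarrow>
     (\<forall>y\<in>X. (\<lambda>x. K x y) \<in> B \<and> (\<forall>g\<in>B. s g (\<lambda>x. K x y) = g y))"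

text \<open>The functional \<open>h\<^sup>*\<close>, vanishing off \<open>B\<close> as the elements of \<open>dual_space\<close> do.\<close>

definition sip_functional ::
  "('a \<Rightarrow> complex) set \<Rightarrow> (('a \<Rightarrow> complex) \<Rightarrow> ('a \<Rightarrow> complex) \<Rightarrow> complex) \<Rightarrow>
   ('a \<Rightarrow> complex) \<Rightarrow> (('a \<Rightarrow> complex) \<Rightarrow> complex)" where
  "sip_functional B s h = (\<lambda>g. if g \<in> B then s g h else 0)"

text \<open>The inverse of \<open>h \<mapsto> h\<^sup>*\<close>, meaningful on the dual by the Riesz representation theorem.\<close>

definition riesz_rep ::
  "('a \<Rightarrow> complex) set \<Rightarrow> (('a \<Rightarrow> complex) \<Rightarrow> ('a \<Rightarrow> complex) \<Rightarrow> complex) \<Rightarrow>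
   (('a \<Rightarrow> complex) \<Rightarrow> complex) \<Rightarrow> ('a \<Rightarrow> complex)" where
  "riesz_rep B s \<phi> = (THE h. h \<in> B \<and> sip_functional B s h = \<phi>)"

text \<open>
  The values of \<open>f\<close> off \<open>X\<close> play no role here, as the elements of \<open>B1\<close> vanish there.
\<close>

definition multiplier ::
  "('a \<Rightarrow> complex) set \<Rightarrow> ('a \<Rightarrow> complex) set \<Rightarrow> ('a \<Rightarrow> complex) \<Rightarrow> bool" where
  "multiplier B1 B2 f \<longleftrightarrow> (\<forall>h\<in>B1. f * h \<in> B2)"

definition mult_op :: "('a \<Rightarrow> complex) \<Rightarrow> ('a \<Rightarrow> complex) \<Rightarrow> ('a \<Rightarrow> complex)" where
  "mult_op f h = f * h"

text \<open>
  For \<open>T : B1 \<rightarrow> B2\<close>, the adjoint and its domain are first defined at the level of functionals;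
  \<open>sip_adjoint\<close> is the adjoint transported to elements along \<open>h \<leftrightarrow> h\<^sup>*\<close>.
\<close>

definition adjoint_domain ::
  "('a \<Rightarrow> complex) set \<Rightarrow> (('a \<Rightarrow> complex) \<Rightarrow> real) \<Rightarrow> ('b \<Rightarrow> complex) set \<Rightarrow>
   (('b \<Rightarrow> complex) \<Rightarrow> ('b \<Rightarrow> complex) \<Rightarrow> complex) \<Rightarrow> (('a \<Rightarrow> complex) \<Rightarrow> ('b \<Rightarrow> complex)) \<Rightarrow>
   (('b \<Rightarrow> complex) \<Rightarrow> complex) set" where
  "adjoint_domain B1 N1 B2 s2 T =
     {sip_functional B2 s2 g | g.
        g \<in> B2 \<and> continuous_functional_on B1 N1 (sip_functional B2 s2 g \<circ> T)}"

definition dual_adjoint ::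
  "('a \<Rightarrow> complex) set \<Rightarrow> (('a \<Rightarrow> complex) \<Rightarrow> ('b \<Rightarrow> complex)) \<Rightarrow>
   (('b \<Rightarrow> complex) \<Rightarrow> complex) \<Rightarrow> (('a \<Rightarrow> complex) \<Rightarrow> complex)" where
  "dual_adjoint B1 T \<phi> = (\<lambda>h. if h \<in> B1 then (\<phi> \<circ> T) h else 0)"

definition sip_adjoint ::
  "('a \<Rightarrow> complex) set \<Rightarrow> (('a \<Rightarrow> complex) \<Rightarrow> ('a \<Rightarrow> complex) \<Rightarrow> complex) \<Rightarrow>
   ('b \<Rightarrow> complex) set \<Rightarrow> (('b \<Rightarrow> complex) \<Rightarrow> ('b \<Rightarrow> complex) \<Rightarrow> complex) \<Rightarrow>
   (('a \<Rightarrow> complex) \<Rightarrow> ('b \<Rightarrow> complex)) \<Rightarrow> ('b \<Rightarrow> complex) \<Rightarrow> ('a \<Rightarrow> complex)" where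
  "sip_adjoint B1 s1 B2 s2 T g =
     riesz_rep B1 s1 (dual_adjoint B1 T (sip_functional B2 s2 g))"

end

theory Submission
  imports Defs
begin

text \<open>
  Reproduction on both sides gives \<open>[f h, k\<^sub>y\<^sup>2]\<^sub>2 = f(y) h(y) = [h, cnj (f y) k\<^sub>y\<^sup>1]\<^sub>1\<close>, and \<open>h \<mapsto> f(y) h(y)\<close>
  is continuous because point evaluation is. That this determines the adjoint is the uniqueness
  half of the Riesz representation theorem: if \<open>h\<^sup>* = k\<^sup>*\<close>, then \<open>\<parallel>h\<parallel> = \<parallel>k\<parallel>\<close> and
  \<open>\<parallel>h + k\<parallel> \<ge> 2 \<parallel>k\<parallel>\<close>, so \<open>h = k\<close> by strict convexity.
\<close>

lemma fscale_apply [simp]: "(c *\<^sub>F g) x = c * g x"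
  by (simp add: fscale_def)

text \<open>Uniform convexity speaks of unit vectors only, so both vectors are divided by their
  common norm; the zero vector is split off first.\<close>

lemma (in normed_function_space) uniformly_convex_imp_strictly_convex:
  assumes uc: "uniformly_convex B N" and g: "g \<in> B" and h: "h \<in> B"
    and eq: "N g = N h" and ge: "2 * N h \<le> N (g + h)"
  shows "g = h"
proof (cases "N h = 0")
  case True
  then show ?thesis using eq g h norm_eq_zero by metis
next
  case False
  define r where "r = N h"
  have r: "r > 0" using False norm_nonneg[OF h] by (simp add: r_def)
  define c where "c = complex_of_real (1 / r)"
  have c: "cmod c = 1 / r" using r by (simp add: c_def norm_divide)
  have mem: "c *\<^sub>F g \<in> B" "c *\<^sub>F h \<in> B" using g h scale_closed by auto
  have one: "N (c *\<^sub>F g) = 1" "N (c *\<^sub>F h) = 1"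
    using g h eq c r by (auto simp: norm_scale r_def)
  have "c *\<^sub>F g + c *\<^sub>F h = c *\<^sub>F (g + h)" by (auto simp: algebra_simps)
  then have "N (c *\<^sub>F g + c *\<^sub>F h) = N (g + h) / r"
    using c g h by (simp add: norm_scale add_closed)
  then have two: "N (c *\<^sub>F g + c *\<^sub>F h) \<ge> 2"
    using ge r by (simp add: r_def pos_le_divide_eq)
  \<comment> \<open>If the distance of the two unit vectors were positive, it could itself serve as
    \<open>\<epsilon>\<close>, and the resulting \<open>\<delta>\<close> would push the norm of
    their sum below 2.\<close>
  have "N (c *\<^sub>F g - c *\<^sub>F h) = 0"
  proof (rule ccontr)
    assume "N (c *\<^sub>F g - c *\<^sub>F h) \<noteq> 0"
    then have "N (c *\<^sub>F g - c *\<^sub>F h) > 0"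
      using norm_nonneg[OF diff_closed[OF mem]] by simp
    then obtain \<delta> where "\<delta> > 0" "N (c *\<^sub>F g + c *\<^sub>F h) \<le> 2 - \<delta>"
      using uc mem one unfolding uniformly_convex_def by blast
    then show False using two by simp
  qed
  then have "c *\<^sub>F g - c *\<^sub>F h = 0" using norm_eq_zero diff_closed mem by blast
  then have "c * g x = c * h x" for x
    by (metis fscale_apply right_minus_eq)
  moreover have "c \<noteq> 0" using r by (simp add: c_def)
  ultimately show ?thesis by auto
qed

text \<open>Since \<open>s\<close> need not be additive in its second variable, \<open>h - k\<close>
  cannot simply be tested against itself; the argument goes through norms instead.\<close>

lemma (in normed_function_space) sip_functional_inj_on:
  assumes uc: "uniformly_convex B N" and sip: "compatible_sip B N s"
  shows "inj_on (sip_functional B s) B"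
proof (rule inj_onI)
  fix h k assume h: "h \<in> B" and k: "k \<in> B"
    and "sip_functional B s h = sip_functional B s k"
  then have eq: "s g h = s g k" if "g \<in> B" for g
    using that by (metis sip_functional_def)
  have self: "s g g = complex_of_real ((N g)\<^sup>2)" if "g \<in> B" for g
    using sip that by (simp add: compatible_sip_def)
  have bound: "cmod (s g g') \<le> N g * N g'" if "g \<in> B" "g' \<in> B" for g g'
    using sip that by (simp add: compatible_sip_def)
  \<comment> \<open>Cauchy-Schwarz with one factor \<open>N g\<close> cancelled. It is used for
    \<open>h\<close>, \<open>k\<close> in both orders.\<close>
  have le: "N g \<le> N g'" if "g \<in> B" "g' \<in> B" "s g g = s g g'" for g g'
  proof -
    have "N g * N g \<le> N g * N g'"
      using bound[OF that(1,2)] self[OF that(1)] that(3)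
      by (metis abs_of_nonneg norm_of_real power2_eq_square zero_le_power2)
    then show ?thesis
      using norm_nonneg[OF that(1)] norm_nonneg[OF that(2)]
      by (cases "N g = 0") (auto simp: mult_le_cancel_left)
  qed
  have same: "N h = N k" using le h k eq by (metis order_antisym)
  \<comment> \<open>The sum stands in the first variable, where additivity holds; there
    \<open>s h k = s h h\<close>.\<close>
  have "s (h + k) k = s h k + s k k"
    using sip h k by (simp add: compatible_sip_def linear_functional_on_def)
  also have "\<dots> = complex_of_real (2 * (N k)\<^sup>2)"
    using eq[OF h] self[OF h] self[OF k] same by simp
  finally have "cmod (s (h + k) k) = 2 * (N k)\<^sup>2" by (simp add: norm_mult norm_power)
  then have "(2 * N k) * N k \<le> N (h + k) * N k"
    using bound[OF add_closed[OF h k] k] by (simp add: power2_eq_square)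
  then have "2 * N k \<le> N (h + k)"
    using norm_nonneg[OF k] norm_nonneg[OF add_closed[OF h k]]
    by (cases "N k = 0") (auto simp: mult_le_cancel_right)
  then show "h = k" using uniformly_convex_imp_strictly_convex[OF uc h k same] by simp
qed

text \<open>Here \<open>h\<close> itself witnesses existence for the definite description, and
  injectivity gives uniqueness.\<close>

lemma riesz_rep_sip_functional:
  assumes "sip_rkbs X B N" and "compatible_sip B N s" and "h \<in> B"
  shows "riesz_rep B s (sip_functional B s h) = h"
proof -
  interpret banach_function_space X B N using assms by (simp add: sip_rkbs_def rkbs_def)
  have "inj_on (sip_functional B s) B"
    using sip_functional_inj_on assms by (simp add: sip_rkbs_def)
  then show ?thesis
    unfolding riesz_rep_def using assms(3) by (auto dest: inj_onD)
qed

theorem theorem2p4: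
  fixes X :: "'a set"
    and B1 B2 :: "('a \<Rightarrow> complex) set"
    and N1 N2 :: "('a \<Rightarrow> complex) \<Rightarrow> real"
    and s1 s2 :: "('a \<Rightarrow> complex) \<Rightarrow> ('a \<Rightarrow> complex) \<Rightarrow> complex"
    and K1 K2 :: "'a \<Rightarrow> 'a \<Rightarrow> complex"
    and f :: "'a \<Rightarrow> complex"
    and y :: 'a
  assumes "sip_rkbs X B1 N1" and "sip_rkbs X B2 N2"
    and "compatible_sip B1 N1 s1" and "compatible_sip B2 N2 s2"
    and "reproducing_kernel X B1 s1 K1" and "reproducing_kernel X B2 s2 K2"
    and "multiplier B1 B2 f"
    and "y \<in> X"
  shows "sip_functional B2 s2 (\<lambda>x. K2 x y) \<in> adjoint_domain B1 N1 B2 s2 (mult_op f) \<and>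
         sip_adjoint B1 s1 B2 s2 (mult_op f) (\<lambda>x. K2 x y) = cnj (f y) *\<^sub>F (\<lambda>x. K1 x y)"
proof
  interpret B1: banach_function_space X B1 N1
    using assms(1) by (simp add: sip_rkbs_def rkbs_def)
  have k1: "(\<lambda>x. K1 x y) \<in> B1" "\<And>g. g \<in> B1 \<Longrightarrow> s1 g (\<lambda>x. K1 x y) = g y"
    and k2: "(\<lambda>x. K2 x y) \<in> B2" "\<And>g. g \<in> B2 \<Longrightarrow> s2 g (\<lambda>x. K2 x y) = g y"
    using assms(5,6,8) by (auto simp: reproducing_kernel_def)
  have comp: "(sip_functional B2 s2 (\<lambda>x. K2 x y) \<circ> mult_op f) h = f y * h y" if "h \<in> B1" for h
    using that assms(7) k2(2)[of "f * h"]
    by (simp add: sip_functional_def mult_op_def multiplier_def)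
  have "continuous_functional_on B1 N1 (\<lambda>h. h y)"
    using assms(1,8) by (simp add: sip_rkbs_def rkbs_def)
  then have "continuous_map B1.metric.mtopology euclidean (\<lambda>h. f y * h y)"
    unfolding continuous_functional_on_def continuous_map_atin by (auto intro: tendsto_intros)
  \<comment> \<open>The two maps are known to agree only on \<open>B1\<close>, which suffices
    because it is the whole topological space.\<close>
  then have "continuous_functional_on B1 N1 (sip_functional B2 s2 (\<lambda>x. K2 x y) \<circ> mult_op f)"
    unfolding continuous_functional_on_def
    by (rule continuous_map_eq) (metis B1.metric.topspace_mtopology comp)
  then show "sip_functional B2 s2 (\<lambda>x. K2 x y) \<in> adjoint_domain B1 N1 B2 s2 (mult_op f)"
    using k2(1) by (auto simp: adjoint_domain_def)
  \<comment> \<open>Conjugate homogeneity in the second variable turns \<open>cnj (f y)\<close> back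
    into \<open>f y\<close>.\<close>
  have "s1 h (cnj (f y) *\<^sub>F (\<lambda>x. K1 x y)) = f y * h y" if "h \<in> B1" for h
    using assms(3) that k1 by (simp add: compatible_sip_def)
  \<comment> \<open>Equality as total functions: both sides are 0 off \<open>B1\<close>.\<close>
  then have "dual_adjoint B1 (mult_op f) (sip_functional B2 s2 (\<lambda>x. K2 x y)) =
      sip_functional B1 s1 (cnj (f y) *\<^sub>F (\<lambda>x. K1 x y))"
    using comp by (auto simp: dual_adjoint_def sip_functional_def)
  then show "sip_adjoint B1 s1 B2 s2 (mult_op f) (\<lambda>x. K2 x y) = cnj (f y) *\<^sub>F (\<lambda>x. K1 x y)"
    using riesz_rep_sip_functional[OF assms(1,3)] B1.scale_closed[OF k1(1)]
    by (simp add: sip_adjoint_def)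
qed

end
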